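(* Let $P$ be a finite, graded, bounded poset of rank $n$. Then $$\mathrm{ex}\Psi_P(y,\mathbf{a},\mathbf{b}) = \sum_{T\subseteq\{0,\dots,n-1\}} \beta(T)\cdot\omega(\mathrm{m}_T),$$ where $\mathrm{m}_T=m_0\cdots m_{n-1}$ with $m_i=\mathbf{b}$ if $i\in T$ and $m_i=\mathbf{a}$ if $i\notin T$. In particular, $\mathrm{ex}\Psi_P(y,\mathbf{a},\mathbf{b})$ has nonnegative coefficients whenever the flag $h$-vector of $P$ is nonnegative (that is, $\beta(T)\ge 0$ for all $T\subseteq\{0,\dots,n-1\}$).
   Context: A finite, graded, bounded poset $P$ of rank $n$ is a finite poset with a unique minimum element $\hat 0$ and a unique maximum element $\hat 1$ of rank $n$, where for every $w \in P$ all maximal chains from $\hat 0$ to $w$ have the same length $\mathrm{rk}(w)$. The Möbius function is given by $\mu(w,w)=1$ for all $w\in P$ and $\mu(u,w) = -\sum_{u\le v<w}\mu(u,v)$ for $u<w$. The Poincaré polynomial is $\mathrm{Poin}_P(y)=\sum_{w\in P}\mu(\hat 0,w)(-y)^{\mathrm{rk}(w)}$. Each interval $[u,w]\subseteq P$ is itself a finite, graded, bounded poset (with its own rank function $v \mapsto \mathrm{rk}(v)-\mathrm{rk}(u)$), so $\mathrm{Poin}_{[u,w]}(y)$ is defined. Chains are sets of pairwise comparable elements $\mathcal{C}=\{\mathcal{C}_1<\dots<\mathcal{C}_k<\mathcal{C}_{k+1}\}$ in $P$ (not necessarily maximal, $k \geq 0$), always assumed to end in $\mathcal{C}_{k+1}=\hat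 1$. Put $\mathrm{Poin}_{P,\mathcal{C}}(y)=\prod_{i=1}^k \mathrm{Poin}_{[\mathcal{C}_i,\mathcal{C}_{i+1}]}(y)$. Let $\mathbb{Z}[y]\langle \mathbf{a},\mathbf{b}\rangle$ be the polynomial ring in two noncommuting variables $\mathbf{a},\mathbf{b}$ with coefficients in $\mathbb{Z}[y]$ ($y$ commutes with everything). For $S\subseteq\{0,\dots,n-1\}$ let $\mathsf{wt}_S(\mathbf{a},\mathbf{b})=w_0\cdots w_{n-1}$ with $w_k=\mathbf{b}$ if $k\in S$ and $w_k=\mathbf{a}-\mathbf{b}$ if $k\notin S$; for a chain $\mathcal{C}$ let $\mathsf{wt}_{\mathcal{C}}=\mathsf{wt}_{\{\mathrm{rk}(\mathcal{C}_1),\dots,\mathrm{rk}(\mathcal{C}_k)\}}$. The extended $\mathbf{ab}$-index is $\mathrm{ex}\Psi_P(y,\mathbf{a},\mathbf{b})=\sum_{\mathcal{C}}\mathrm{Poin}_{P,\mathcal{C}}(y)\cdot\mathsf{wt}_{\mathcal{C}}(\mathbf{a},\mathbf{b})$, the sum over all chains $\mathcal{C}=\{\mathcal{C}_1<\dots<\mathcal{C}_{k+1}=\hat 1\}$ in $P$. For $S\subseteq\{0,\dots,n-1\}$, the flag $f$-vector entry $\alpha(S)$ is the number of maximal chains in the subposet of $P$ consisting of the elements whose rank lies in $S$ (so $\alpha(\emptyset)=1$), and the flag $h$-vector is $\beta(T)=\sum_{S\subseteq T}(-1)^{|T\setminus S|}\alpha(S)$. The transformation $\omega$ takes a monomial in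 $\mathbf{a},\mathbf{b}$, replaces all occurrences of $\mathbf{a}\mathbf{b}$ with $(1+y)\mathbf{a}\mathbf{b}+(y+y^2)\mathbf{b}\mathbf{a}$ and then simultaneously replaces all remaining occurrences of $\mathbf{a}$ with $\mathbf{a}+y\mathbf{b}$ and of $\mathbf{b}$ with $\mathbf{b}+y\mathbf{a}$ (the replacements act on the letters of the original monomial, not on letters produced by an earlier replacement; in particular $\omega(1)=1$). "Coefficients" of the extended $\mathbf{ab}$-index are the integer coefficients of $y^j$ times $\mathbf{ab}$-monomials. *)

theory Defs
  imports
    Main
    "HOL-Library.Poly_Mapping"
    "HOL-Computational_Algebra.Polynomial"
begin

section \<open>Finite graded bounded posets\<close>

text \<open>
  A poset is a set of elements of an ordered type with the induced order. The interval
  from \<open>u\<close> to \<open>w\<close> in \<open>P\<close> is the poset \<open>P \<inter> {u..w}\<close>.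
\<close>

definition poset_bot :: "'a::order set \<Rightarrow> 'a" where
  "poset_bot P = (LEAST x. x \<in> P)"

definition poset_top :: "'a::order set \<Rightarrow> 'a" where
  "poset_top P = (GREATEST x. x \<in> P)"

text \<open>
  In a poset with a minimum, the maximal chains from the minimum to \<open>w\<close> are exactly the
  maximal chains of the poset \<open>P \<inter> {..w}\<close>; the length of a chain is its cardinality minus one.
\<close>

definition fin_graded_bounded :: "'a::order set \<Rightarrow> bool" where
  "fin_graded_bounded P \<longleftrightarrow>
     finite P \<and>
     (\<exists>b\<in>P. \<forall>w\<in>P. b \<le> w) \<and>
     (\<exists>t\<in>P. \<forall>w\<in>P. w \<le> t) \<and>
     (\<forall>w\<in>P. \<forall>C D. pred_on.maxchain (P \<inter> {..w}) (<) C \<longrightarrow>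
                   pred_on.maxchain (P \<inter> {..w}) (<) D \<longrightarrow> card C = card D)"

definition rk :: "'a::order set \<Rightarrow> 'a \<Rightarrow> nat" where
  "rk P w = (THE r. \<exists>C. pred_on.maxchain (P \<inter> {..w}) (<) C \<and> card C = Suc r)"

definition poset_rank :: "'a::order set \<Rightarrow> nat" where
  "poset_rank P = rk P (poset_top P)"

text \<open>The guard \<open>finite P\<close> only serves termination; values for \<open>\<not> u \<le> w\<close> are irrelevant.\<close>

function mobius :: "'a::order set \<Rightarrow> 'a \<Rightarrow> 'a \<Rightarrow> int" where
  "mobius P u w =
     (if u = w then 1
      else if finite P \<and> u < w then - (\<Sum>v\<in>P \<inter> {u..<w}. mobius P u v)
      else 0)"
  by pat_completeness auto
termination
proof (relation "measure (\<lambda>(P, u, w). card (P \<inter> {u..<w}))")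
  fix P :: "'a::order set" and u w v
  assume fin: "finite P \<and> u < w" and v: "v \<in> P \<inter> {u..<w}"
  have "P \<inter> {u..<v} \<subseteq> P \<inter> {u..<w}"
    using v by auto
  moreover have "v \<in> P \<inter> {u..<w} - P \<inter> {u..<v}"
    using v by auto
  ultimately have "P \<inter> {u..<v} \<subset> P \<inter> {u..<w}"
    by blast
  then show "((P, u, v), (P, u, w)) \<in> measure (\<lambda>(P, u, w). card (P \<inter> {u..<w}))"
    using fin by (simp add: psubset_card_mono)
qed simp

declare mobius.simps [simp del]

text \<open>The Poincare polynomial; the variable \<open>y\<close> is \<open>[:0, 1:]\<close>.\<close>

definition Poin :: "'a::order set \<Rightarrow> int poly" where
  "Poin P = (\<Sum>w\<in>P. smult (mobius P (poset_bot P) w) ((- [:0, 1:]) ^ rk P w))"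

definition top_chains :: "'a::order set \<Rightarrow> 'a set set" where
  "top_chains P = {C. pred_on.chain P (<) C \<and> poset_top P \<in> C}"

text \<open>
  For \<open>c = C\<^sub>i\<close> in a chain \<open>C\<^sub>1 < \<dots> < C\<^sub>k < C\<^bsub>k+1\<^esub>\<close> with \<open>i \<le> k\<close>, the element \<open>chain_next C c\<close>
  is \<open>C\<^bsub>i+1\<^esub>\<close>.
\<close>

definition chain_next :: "'a::order set \<Rightarrow> 'a \<Rightarrow> 'a" where
  "chain_next C c = (LEAST d. d \<in> C \<and> c < d)"

definition Poin_chain :: "'a::order set \<Rightarrow> 'a set \<Rightarrow> int poly" where
  "Poin_chain P C = (\<Prod>c\<in>C - {poset_top P}. Poin (P \<inter> {c..chain_next C c}))"

definition flag_f :: "'a::order set \<Rightarrow> nat set \<Rightarrow> nat" where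
  "flag_f P S = card {C. pred_on.maxchain {w \<in> P. rk P w \<in> S} (<) C}"

definition flag_h :: "'a::order set \<Rightarrow> nat set \<Rightarrow> int" where
  "flag_h P T = (\<Sum>S\<in>Pow T. (-1) ^ card (T - S) * int (flag_f P S))"


section \<open>Polynomials over \<open>\<int>[y]\<close> in two noncommuting variables\<close>

text \<open>
  Monomials form the free monoid on two letters, written additively so that
  \<open>ab_word \<Rightarrow>\<^sub>0 int poly\<close>, with the convolution product of the library, is its monoid algebra.
\<close>

datatype ab_letter = La | Lb

datatype ab_word = Word "ab_letter list"

instantiation ab_word :: monoid_add
begin

definition zero_ab_word :: ab_word where
  "0 = Word []"

fun plus_ab_word :: "ab_word \<Rightarrow> ab_word \<Rightarrow> ab_word" where
  "Word u + Word v = Word (u @ v)"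

instance
proof
  fix u v w :: ab_word
  show "u + v + w = u + (v + w)"
    by (cases u; cases v; cases w) simp
  show "0 + u = u"
    by (cases u) (simp add: zero_ab_word_def)
  show "u + 0 = u"
    by (cases u) (simp add: zero_ab_word_def)
qed

end

type_synonym ab_poly = "ab_word \<Rightarrow>\<^sub>0 int poly"

definition ab_const :: "int poly \<Rightarrow> ab_poly" where
  "ab_const p = Poly_Mapping.single 0 p"

definition var_y :: ab_poly where
  "var_y = ab_const [:0, 1:]"

definition var_a :: ab_poly where
  "var_a = Poly_Mapping.single (Word [La]) 1"

definition var_b :: ab_poly where
  "var_b = Poly_Mapping.single (Word [Lb]) 1"

definition wt :: "nat \<Rightarrow> nat set \<Rightarrow> ab_poly" where
  "wt n S = prod_list (map (\<lambda>k. if k \<in> S then var_b else var_a - var_b) [0..<n])"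

definition wt_chain :: "'a::order set \<Rightarrow> 'a set \<Rightarrow> ab_poly" where
  "wt_chain P C = wt (poset_rank P) (rk P ` (C - {poset_top P}))"

definition ex_ab_index :: "'a::order set \<Rightarrow> ab_poly" where
  "ex_ab_index P = (\<Sum>C\<in>top_chains P. ab_const (Poin_chain P C) * wt_chain P C)"

definition mono_of :: "nat \<Rightarrow> nat set \<Rightarrow> ab_word" where
  "mono_of n T = Word (map (\<lambda>i. if i \<in> T then Lb else La) [0..<n])"

text \<open>
  Occurrences of the factor \<open>ab\<close> in a monomial never overlap, so reading the monomial from
  left to right and replacing each \<open>ab\<close> as it is met carries out the simultaneous replacement;
  every letter outside such a factor is replaced on its own.
\<close>

fun omega_letters :: "ab_letter list \<Rightarrow> ab_poly" where
  "omega_letters [] = 1"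
| "omega_letters (La # Lb # w) =
     ((1 + var_y) * var_a * var_b + (var_y + var_y ^ 2) * var_b * var_a) * omega_letters w"
| "omega_letters (La # w) = (var_a + var_y * var_b) * omega_letters w"
| "omega_letters (Lb # w) = (var_b + var_y * var_a) * omega_letters w"

fun omega :: "ab_word \<Rightarrow> ab_poly" where
  "omega (Word w) = omega_letters w"

end

theory Submission
  imports Defs "HOL-Library.FuncSet"
begin

text \<open>
  Write \<open>d\<close> for \<open>a - b\<close>. By Hall's theorem \<open>Poin\<close> of an interval \<open>[u, v]\<close> is a signed sum
  over chains \<open>u = x\<^sub>0 < \<dots> < x\<^sub>k = w\<close> with \<open>w \<le> v\<close>, with weight
  \<open>(-1)\<^sup>k (-y)\<^bsup>rk w - rk u\<^esup>\<close>. Expanding every factor \<open>Poin\<close> in the extended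
  \<open>ab\<close>-index therefore gives a sum over chains \<open>D\<close> of \<open>P\<close>, each carrying a set of markings that say
  which elements of \<open>D\<close> belong to the original chain and where the Hall chains end. The total weight
  of all markings of \<open>D\<close> depends only on the set of ranks of \<open>D\<close>. Reading the ranks from
  below, it is a product of \<open>2 \<times> 2\<close> matrices over the states \<open>free\<close> (no Hall chain is open) and
  \<open>tied\<close> (one is open):
  \<open>E = diag(d, - y d)\<close> for a rank that is missed and \<open>F = (b, -a)\<^sup>t (1, -y)\<close> for a rank
  that is met, applied to the final column \<open>(1, -1)\<^sup>t\<close>. These weights are \<open>free_wt\<close> and
  \<open>tied_wt\<close>, and the extended \<open>ab\<close>-index is the sum of \<open>\<alpha>(S)\<close> times the weight of \<open>S\<close>.

  Passing from \<open>\<alpha>\<close> to \<open>\<beta>\<close> replaces \<open>E\<close> by \<open>E + F\<close>, which happens to have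
  rank one as well: \<open>E + F = (1, -1)\<^sup>t (a, - y b)\<close>. So in the product belonging to a word in
  \<open>a\<close> (matrix \<open>E + F\<close>) and \<open>b\<close> (matrix \<open>F\<close>) only the scalar products of a row with the
  column that follows survive: \<open>aa\<close>, or a final \<open>a\<close>, gives \<open>a + y b\<close>, \<open>bb\<close> gives \<open>b + y a\<close>,
  \<open>ab\<close> gives \<open>a b + y b a\<close>, and \<open>ba\<close>, or a final \<open>b\<close>, gives \<open>1 + y\<close>. Every
  factor \<open>1 + y\<close> is paired with the last \<open>ab\<close> before it and turns it into
  \<open>(1 + y) a b + (y + y\<^sup>2) b a\<close>; this is \<open>\<omega>\<close>. A word that starts with \<open>b\<close> would come
  out differently, but there \<open>\<beta>(T) = 0\<close>, since the only element of rank \<open>0\<close> is the minimum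
  (\<open>flag_h_eq_0\<close>). The passage from \<open>\<alpha>\<close> to \<open>\<beta>\<close> is \<open>alternating_sum_omega\<close>.

  The expansion over chains is carried out without Hall's theorem: fixing the least element \<open>u\<close>
  of the chains, both the original sum and the sum of matrix weights satisfy a recursion in
  \<open>u\<close>, and the two recursions agree by the Moebius inversion identity
  \<open>\<Sum>\<^bsub>u \<le> v \<le> w\<^esub> (-y)\<^bsup>rk v - rk u\<^esup> Poin [v, w] = 1\<close>
  (\<open>sum_Poin_upper_intervals\<close>, \<open>flag_sums_eq\<close>). Nonnegativity follows because the coefficients
  of every \<open>\<omega>(m)\<close> are nonnegative.
\<close>

section \<open>Scalars and nonnegative coefficients\<close>

text \<open>
  Bilinear statements about products, such as centrality of the scalars and nonnegativity, reduce
  through this decomposition to products of two monomials.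
\<close>

lemma poly_mapping_eq_sum_single:
  "f = (\<Sum>k\<in>Poly_Mapping.keys f. Poly_Mapping.single k (Poly_Mapping.lookup f k))"
  by (rule poly_mapping_eqI)
    (auto simp: lookup_sum lookup_single when_def in_keys_iff sum.delta)

lemma ab_const_commute: "ab_const p * f = f * ab_const p"
proof -
  have "ab_const p * Poly_Mapping.single k q = Poly_Mapping.single k q * ab_const p" for k q
    by (simp add: ab_const_def mult_single mult.commute)
  then show ?thesis
    by (subst (1 2) poly_mapping_eq_sum_single[of f])
      (simp add: sum_distrib_left sum_distrib_right)
qed

lemma ab_const_left_commute: "f * (ab_const p * g) = ab_const p * (f * g)"
  by (metis ab_const_commute mult.assoc)

lemma ab_const_mult: "ab_const (p * q) = ab_const p * ab_const q"
  by (simp add: ab_const_def mult_single)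

lemma ab_const_add: "ab_const (p + q) = ab_const p + ab_const q"
  by (simp add: ab_const_def single_add)

lemma ab_const_0 [simp]: "ab_const 0 = 0"
  by (simp add: ab_const_def)

lemma ab_const_1 [simp]: "ab_const 1 = 1"
  by (simp add: ab_const_def)

lemma ab_const_diff: "ab_const (p - q) = ab_const p - ab_const q"
  by (simp add: ab_const_def single_diff)

lemma ab_const_uminus: "ab_const (- p) = - ab_const p"
  by (simp add: ab_const_def single_uminus)

lemma ab_const_sum: "ab_const (sum f A) = (\<Sum>x\<in>A. ab_const (f x))"
  by (induction A rule: infinite_finite_induct) (simp_all add: ab_const_add)

lemma ab_const_power: "ab_const (p ^ k) = ab_const p ^ k"
  by (induction k) (simp_all add: ab_const_mult)

lemma ab_const_neg_y_power: "ab_const ((- [:0, 1:]) ^ k) = (- var_y) ^ k"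
  by (simp add: ab_const_power ab_const_uminus var_y_def del: minus_pCons)

lemma var_y_commute: "f * var_y = var_y * f"
  by (simp add: var_y_def ab_const_commute)

lemma var_y_left_commute: "f * (var_y * g) = var_y * (f * g)"
  by (simp add: var_y_def ab_const_left_commute)

text \<open>
  Instances for fixed left factors only: as a rewrite rule, commutation of \<open>var_y\<close> with an
  arbitrary element would also apply to \<open>var_y\<close> itself and not terminate.
\<close>

lemmas var_y_to_front =
  var_y_commute[of var_a] var_y_commute[of var_b] var_y_commute[of "omega_letters w" for w]
  var_y_left_commute[of var_a] var_y_left_commute[of var_b]
  var_y_left_commute[of "omega_letters w" for w]

definition ab_nonneg :: "ab_poly \<Rightarrow> bool" where
  "ab_nonneg f \<longleftrightarrow> (\<forall>m j. 0 \<le> coeff (Poly_Mapping.lookup f m) j)"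

lemma ab_nonneg_add: "ab_nonneg f \<Longrightarrow> ab_nonneg g \<Longrightarrow> ab_nonneg (f + g)"
  by (simp add: ab_nonneg_def lookup_add)

lemma ab_nonneg_sum: "(\<And>x. x \<in> A \<Longrightarrow> ab_nonneg (f x)) \<Longrightarrow> ab_nonneg (sum f A)"
  by (simp add: ab_nonneg_def lookup_sum coeff_sum sum_nonneg)

lemma ab_nonneg_mult:
  assumes "ab_nonneg f" "ab_nonneg g"
  shows "ab_nonneg (f * g)"
proof -
  have "ab_nonneg (Poly_Mapping.single k (Poly_Mapping.lookup f k) *
      Poly_Mapping.single l (Poly_Mapping.lookup g l))" for k l
    using assms
    by (auto simp: ab_nonneg_def mult_single lookup_single when_def coeff_mult intro!: sum_nonneg)
  then show ?thesis
    by (subst poly_mapping_eq_sum_single[of f], subst poly_mapping_eq_sum_single[of g])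
      (auto simp: sum_product intro!: ab_nonneg_sum)
qed

lemma ab_nonneg_basic:
  "ab_nonneg 1" "ab_nonneg var_a" "ab_nonneg var_b" "ab_nonneg var_y"
  by (auto simp: ab_nonneg_def lookup_one var_a_def var_b_def var_y_def ab_const_def
      lookup_single when_def coeff_pCons split: nat.splits)

lemma ab_nonneg_of_int: "0 \<le> k \<Longrightarrow> ab_nonneg (of_int k)"
proof -
  assume "0 \<le> k"
  moreover have "ab_nonneg (of_nat m)" for m
    by (induction m) (auto simp: ab_nonneg_add ab_nonneg_basic, simp add: ab_nonneg_def)
  ultimately show ?thesis
    by (metis of_int_of_nat_eq nonneg_int_cases)
qed

lemma ab_nonneg_omega: "ab_nonneg (omega m)"
proof -
  have "ab_nonneg (omega_letters w)" for w
    by (induction w rule: omega_letters.induct)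
      (auto simp: power2_eq_square intro!: ab_nonneg_mult ab_nonneg_add ab_nonneg_basic)
  then show ?thesis
    by (cases m) simp
qed

section \<open>The matrix weights of rank sets and the transformation omega\<close>

text \<open>
  The two entries of the column obtained by applying the matrices \<open>E\<close> (letter \<open>La\<close>, rank missed)
  and \<open>F\<close> (letter \<open>Lb\<close>, rank met) of a word to the column \<open>(1, -1)\<^sup>t\<close>. While a Hall
  chain stays open, every rank costs a factor \<open>-y\<close>. An element met in the tied state may be an
  inner element of the open Hall chain (\<open>- (-y) d = y d\<close>), its end inside the interval (\<open>-d\<close>), or its end at
  the next element of the original chain (\<open>-b\<close>, or \<open>y b\<close> if a new Hall chain opens), in total
  \<open>-a\<close> and \<open>y a\<close>. The final \<open>-1\<close> closes a chain at the maximum.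
\<close>

fun free_wt and tied_wt :: "ab_letter list \<Rightarrow> ab_poly" where
  "free_wt [] = 1"
| "free_wt (La # w) = (var_a - var_b) * free_wt w"
| "free_wt (Lb # w) = var_b * (free_wt w - var_y * tied_wt w)"
| "tied_wt [] = - 1"
| "tied_wt (La # w) = - (var_y * (var_a - var_b)) * tied_wt w"
| "tied_wt (Lb # w) = - var_a * (free_wt w - var_y * tied_wt w)"

text \<open>
  In closed form, the two entries of the column obtained in the same way with \<open>E + F\<close> in place of
  \<open>E\<close>; that these formulas satisfy the matrix recursion is the content of the next two lemmas. As
  \<open>E + F\<close> and \<open>F\<close> have rank one, the first letter of a word fixes the direction of the column:
  \<open>(1, -1)\<^sup>t\<close> for \<open>La\<close> and \<open>(b, -a)\<^sup>t\<close> for \<open>Lb\<close>.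
\<close>

fun free_omega :: "ab_letter list \<Rightarrow> ab_poly" where
  "free_omega [] = 1"
| "free_omega (La # w) = omega_letters (La # w)"
| "free_omega (Lb # w) = var_b * ((1 + var_y) * omega_letters w)"

fun tied_omega :: "ab_letter list \<Rightarrow> ab_poly" where
  "tied_omega [] = - 1"
| "tied_omega (La # w) = - omega_letters (La # w)"
| "tied_omega (Lb # w) = - var_a * ((1 + var_y) * omega_letters w)"

text \<open>
  The rows \<open>(a, - y b)\<close> of \<open>E + F\<close> and \<open>(1, -y)\<close> of \<open>F\<close>, applied to the column of \<open>w\<close>, give the
  factor that multiplies the direction of the column of \<open>La # w\<close> and \<open>Lb # w\<close>, respectively. The
  factor \<open>1 + y\<close> that \<open>Lb\<close> leaves in front of \<open>\<omega>(w)\<close> waits for the \<open>La\<close> that completes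
  an occurrence of \<open>ab\<close>.
\<close>

lemma omega_letters_La:
  "omega_letters (La # w) = var_a * free_omega w - var_y * var_b * tied_omega w"
proof (cases w)
  case (Cons l v)
  then show ?thesis
    by (cases l) (simp_all add: algebra_simps power2_eq_square var_y_to_front)
qed (simp add: algebra_simps)

lemma omega_letters_Lb:
  "(1 + var_y) * omega_letters w = free_omega w - var_y * tied_omega w"
proof (cases w)
  case (Cons l v)
  then show ?thesis
    by (cases l) (simp_all add: algebra_simps var_y_to_front)
qed (simp add: algebra_simps)

definition segment_word :: "nat set \<Rightarrow> nat \<Rightarrow> nat \<Rightarrow> ab_letter list" where
  "segment_word S i n = map (\<lambda>k. if k \<in> S then Lb else La) [i..<n]"

lemma mono_of_eq: "mono_of n T = Word (segment_word T 0 n)"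
  by (simp add: mono_of_def segment_word_def)

lemma segment_word_rec:
  "i < n \<Longrightarrow> segment_word S i n = (if i \<in> S then Lb else La) # segment_word S (Suc i) n"
  unfolding segment_word_def by (subst upt_conv_Cons) simp_all

lemma segment_word_empty [simp]: "segment_word S n n = []"
  by (simp add: segment_word_def)

lemma segment_word_cong:
  "S \<inter> {i..<n} = T \<inter> {i..<n} \<Longrightarrow> segment_word S i n = segment_word T i n"
  unfolding segment_word_def by (rule map_cong) (auto simp: set_eq_iff)

lemma segment_word_gap:
  assumes "i \<le> j" "j \<le> n" "S \<inter> {i..<j} = {}"
  shows "segment_word S i n = replicate (j - i) La @ segment_word S j n"
proof -
  have "map (\<lambda>k. if k \<in> S then Lb else La) [i..<j] = replicate (j - i) La"
    using assms(3) by (intro nth_equalityI) auto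
  then show ?thesis
    using assms upt_add_eq_append[of i j "n - j"]
    by (simp add: segment_word_def)
qed

text \<open>
  The matrix of a missed rank is the difference \<open>E = (E + F) - F\<close>; expanding the product of
  the matrices over all missed ranks gives the alternating sum over the sets \<open>U\<close> of those ranks at
  which \<open>F\<close> was chosen. Both entries of the column are needed for the induction.
\<close>

lemma alternating_sum_omega:
  assumes "i \<le> n"
  shows "(\<Sum>U\<in>Pow ({i..<n} - S). (- 1) ^ card U * free_omega (segment_word (S \<union> U) i n))
           = free_wt (segment_word S i n) \<and>
         (\<Sum>U\<in>Pow ({i..<n} - S). (- 1) ^ card U * tied_omega (segment_word (S \<union> U) i n))
           = tied_wt (segment_word S i n)"
  using assms
proof (induction i rule: inc_induct)
  case base
  then show ?case by simp
next
  case (step i)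
  let ?D = "{Suc i..<n} - S"
  let ?W = "\<lambda>U. segment_word (S \<union> U) (Suc i) n"
  let ?w = "segment_word S (Suc i) n"
  define altsum :: "(ab_letter list \<Rightarrow> ab_poly) \<Rightarrow> ab_poly"
    where "altsum h = (\<Sum>U\<in>Pow ?D. (- 1) ^ card U * h (?W U))" for h
  have IH: "altsum free_omega = free_wt ?w" "altsum tied_omega = tied_wt ?w"
    using step.IH by (auto simp: altsum_def)
  have sign: "x * ((- 1) ^ k * z) = (- 1) ^ k * (x * z)" for x z :: ab_poly and k :: nat
    by (cases "even k") simp_all
  have pull: "x * altsum h = altsum (\<lambda>w. x * h w)" for x h
    by (simp add: altsum_def sum_distrib_left sign)
  have diff: "altsum h - altsum k = altsum (\<lambda>w. h w - k w)" for h k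
    by (simp add: altsum_def sum_subtractf right_diff_distrib)
  have Lb: "altsum (\<lambda>w. free_omega (Lb # w)) = free_wt (Lb # ?w)"
    "altsum (\<lambda>w. tied_omega (Lb # w)) = tied_wt (Lb # ?w)"
    by (simp_all only: free_omega.simps tied_omega.simps omega_letters_Lb free_wt.simps
        tied_wt.simps IH[symmetric] pull diff)
  have La: "altsum (\<lambda>w. free_omega (La # w)) - altsum (\<lambda>w. free_omega (Lb # w))
      = free_wt (La # ?w)"
    "altsum (\<lambda>w. tied_omega (La # w)) - altsum (\<lambda>w. tied_omega (Lb # w))
      = tied_wt (La # ?w)"
    by (simp_all only: free_omega.simps tied_omega.simps omega_letters_Lb omega_letters_La
        free_wt.simps tied_wt.simps IH[symmetric] pull diff)
      (simp_all add: algebra_simps var_y_to_front)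
  have word_insert: "segment_word (S \<union> insert i U) i n = Lb # ?W U" for U
  proof -
    have "segment_word (S \<union> insert i U) (Suc i) n = ?W U"
      by (rule segment_word_cong) auto
    then show ?thesis
      using step.hyps by (simp add: segment_word_rec)
  qed
  show ?case
  proof (cases "i \<in> S")
    case True
    then have D: "{i..<n} - S = ?D"
      by (auto simp: Suc_le_eq le_less)
    show ?thesis
      using Lb True step.hyps unfolding D altsum_def by (simp add: segment_word_rec)
  next
    case False
    then have D: "{i..<n} - S = insert i ?D"
      using step.hyps by auto
    have notin: "i \<notin> U" "finite U" if "U \<in> Pow ?D" for U
      using that finite_subset[of U ?D] by auto
    have word: "segment_word (S \<union> U) i n = La # ?W U" if "U \<in> Pow ?D" for U
      using False notin(1)[OF that] step.hyps(2) by (subst segment_word_rec) auto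
    have split: "(\<Sum>U\<in>Pow ({i..<n} - S). (- 1) ^ card U * h (segment_word (S \<union> U) i n))
        = altsum (\<lambda>w. h (La # w)) - altsum (\<lambda>w. h (Lb # w))" for h :: "ab_letter list \<Rightarrow> ab_poly"
    proof -
      let ?f = "\<lambda>U. (- 1) ^ card U * h (segment_word (S \<union> U) i n)"
      have inj: "inj_on (insert i) (Pow ?D)"
        using notin by (meson inj_onI insert_ident)
      have "sum ?f (Pow ({i..<n} - S)) = sum ?f (Pow ?D) + sum ?f (insert i ` Pow ?D)"
        unfolding D Pow_insert by (rule sum.union_disjoint) auto
      also have "sum ?f (Pow ?D) = altsum (\<lambda>w. h (La # w))"
        unfolding altsum_def by (rule sum.cong) (simp_all only: word)
      also have "sum ?f (insert i ` Pow ?D) = (\<Sum>U\<in>Pow ?D. ?f (insert i U))"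
        using inj by (simp add: sum.reindex)
      also have "\<dots> = (\<Sum>U\<in>Pow ?D. - ((- 1) ^ card U * h (Lb # ?W U)))"
        by (rule sum.cong[OF refl], subst word_insert)
          (simp add: notin card_insert_disjoint)
      also have "\<dots> = - altsum (\<lambda>w. h (Lb # w))"
        by (simp add: altsum_def sum_negf)
      finally show ?thesis
        by simp
    qed
    have "segment_word S i n = La # ?w"
      using False step.hyps(2) by (subst segment_word_rec) simp_all
    then show ?thesis
      by (simp only: split La)
  qed
qed

text \<open>
  The recursion over chains needs the weight of the ranks from some \<open>i\<close> on; \<open>wt n S\<close> is the case
  \<open>i = 0\<close>.
\<close>

definition word_wt :: "ab_letter list \<Rightarrow> ab_poly" where
  "word_wt w = prod_list (map (\<lambda>l. if l = Lb then var_b else var_a - var_b) w)"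

lemma wt_eq: "wt n S = word_wt (segment_word S 0 n)"
  unfolding wt_def word_wt_def segment_word_def map_map
  by (intro arg_cong[of _ _ prod_list] map_cong) auto

lemma word_wt_simps [simp]:
  "word_wt [] = 1"
  "word_wt (La # w) = (var_a - var_b) * word_wt w"
  "word_wt (Lb # w) = var_b * word_wt w"
  by (simp_all add: word_wt_def)

lemma word_wt_gap: "word_wt (replicate k La @ w) = (var_a - var_b) ^ k * word_wt w"
  by (induction k) (simp_all add: mult.assoc)

lemma free_wt_gap: "free_wt (replicate k La @ w) = (var_a - var_b) ^ k * free_wt w"
  by (induction k) (simp_all add: mult.assoc)

lemma tied_wt_gap:
  "tied_wt (replicate k La @ w) = (- var_y) ^ k * ((var_a - var_b) ^ k * tied_wt w)"
proof (induction k)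
  case (Suc k)
  have "x * (- var_y) ^ k = (- var_y) ^ k * x" for x
    using ab_const_commute[of "(- [:0, 1:]) ^ k" x] by (simp only: ab_const_neg_y_power)
  then have "x * ((- var_y) ^ k * z) = (- var_y) ^ k * (x * z)" for x z
    by (metis mult.assoc)
  with Suc show ?case
    by (simp add: mult.assoc)
qed simp

section \<open>Ranks in graded posets\<close>

lemma chain_less_iff:
  fixes A :: "'a::order set"
  shows "pred_on.chain A (<) C \<longleftrightarrow> C \<subseteq> A \<and> (\<forall>x\<in>C. \<forall>y\<in>C. x \<le> y \<or> y \<le> x)"
  by (auto simp: pred_on.chain_def le_less)

lemma maxchain_less_iff:
  fixes A :: "'a::order set"
  shows "pred_on.maxchain A (<) C \<longleftrightarrow> pred_on.chain A (<) C \<and>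
    (\<forall>x\<in>A. (\<forall>c\<in>C. x \<le> c \<or> c \<le> x) \<longrightarrow> x \<in> C)"
proof (intro iffI conjI ballI impI)
  assume max: "pred_on.maxchain A (<) C"
  then show ch: "pred_on.chain A (<) C"
    by (simp add: pred_on.maxchain_def)
  fix x assume "x \<in> A" "\<forall>c\<in>C. x \<le> c \<or> c \<le> x"
  then have "pred_on.chain A (<) (insert x C)"
    using ch unfolding chain_less_iff by blast
  then show "x \<in> C"
    using max unfolding pred_on.maxchain_def by blast
next
  assume *: "pred_on.chain A (<) C \<and> (\<forall>x\<in>A. (\<forall>c\<in>C. x \<le> c \<or> c \<le> x) \<longrightarrow> x \<in> C)"
  show "pred_on.maxchain A (<) C"
    unfolding pred_on.maxchain_def
  proof (intro conjI notI)
    show "pred_on.chain A (<) C"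
      using * by simp
    assume "\<exists>S. pred_on.chain A (<) S \<and> C \<subset> S"
    then obtain S x where "pred_on.chain A (<) S" "C \<subseteq> S" "x \<in> S" "x \<notin> C"
      by blast
    then have "x \<in> A" "\<forall>c\<in>C. x \<le> c \<or> c \<le> x"
      unfolding chain_less_iff by blast+
    then show False
      using * \<open>x \<notin> C\<close> by blast
  qed
qed

lemma chain_extends_to_maxchain:
  fixes A :: "'a::order set"
  assumes "finite A" "pred_on.chain A (<) C"
  obtains M where "pred_on.maxchain A (<) M" "C \<subseteq> M"
proof -
  let ?E = "{D. pred_on.chain A (<) D \<and> C \<subseteq> D}"
  have "finite ?E"
    by (rule finite_subset[of _ "Pow A"]) (auto simp: chain_less_iff assms(1))
  moreover have "C \<in> ?E"
    using assms(2) by simp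
  ultimately obtain M where "M \<in> ?E" "\<forall>D\<in>?E. M \<le> D \<longrightarrow> M = D"
    using finite_has_maximal2 by (metis (no_types, lifting))
  then have "pred_on.maxchain A (<) M" "C \<subseteq> M"
    unfolding pred_on.maxchain_def by auto
  then show ?thesis
    by (rule that)
qed

locale graded_poset =
  fixes P :: "'a::order set"
  assumes graded: "fin_graded_bounded P"
begin

lemma finite_P [simp]: "finite P"
  using graded by (simp add: fin_graded_bounded_def)

lemma bot_in [simp]: "poset_bot P \<in> P"
  and bot_le: "w \<in> P \<Longrightarrow> poset_bot P \<le> w"
proof -
  obtain b where b: "b \<in> P" "\<And>w. w \<in> P \<Longrightarrow> b \<le> w"
    using graded by (auto simp: fin_graded_bounded_def)
  then have "poset_bot P = b"
    unfolding poset_bot_def by (intro Least_equality) auto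
  with b show "poset_bot P \<in> P" "w \<in> P \<Longrightarrow> poset_bot P \<le> w"
    by auto
qed

lemma top_in [simp]: "poset_top P \<in> P"
  and le_top: "w \<in> P \<Longrightarrow> w \<le> poset_top P"
proof -
  obtain t where t: "t \<in> P" "\<And>w. w \<in> P \<Longrightarrow> w \<le> t"
    using graded by (auto simp: fin_graded_bounded_def)
  then have "poset_top P = t"
    unfolding poset_top_def by (intro Greatest_equality) auto
  with t show "poset_top P \<in> P" "w \<in> P \<Longrightarrow> w \<le> poset_top P"
    by auto
qed

lemma card_maxchain_below:
  assumes "w \<in> P" "pred_on.maxchain (P \<inter> {..w}) (<) C"
  shows "card C = Suc (rk P w)"
proof -
  have "w \<in> C" "finite C"
    using assms by (auto simp: maxchain_less_iff chain_less_iff intro: finite_subset[OF _ finite_P])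
  then have "card C \<noteq> 0"
    by auto
  then have C: "card C = Suc (card C - 1)"
    by simp
  have "rk P w = card C - 1"
    unfolding rk_def
  proof (rule the_equality)
    show "\<exists>D. pred_on.maxchain (P \<inter> {..w}) (<) D \<and> card D = Suc (card C - 1)"
      using assms(2) C by blast
    fix r assume "\<exists>D. pred_on.maxchain (P \<inter> {..w}) (<) D \<and> card D = Suc r"
    then obtain D where "pred_on.maxchain (P \<inter> {..w}) (<) D" "card D = Suc r"
      by blast
    moreover have "card D = card C"
      using graded assms calculation(1) unfolding fin_graded_bounded_def by blast
    ultimately show "r = card C - 1"
      by simp
  qed
  with C show ?thesis
    by simp
qed

text \<open>
  A maximal chain below \<open>u\<close> and a maximal chain of \<open>[u, w]\<close> share only \<open>u\<close>, and their union is a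
  maximal chain below \<open>w\<close>: an element comparable with \<open>u\<close> lies on one side of it.
\<close>

lemma card_maxchain_interval:
  assumes "u \<in> P" "w \<in> P" "u \<le> w" "pred_on.maxchain (P \<inter> {u..w}) (<) D"
  shows "card D + rk P u = Suc (rk P w)"
proof -
  obtain C where C: "pred_on.maxchain (P \<inter> {..u}) (<) C"
    using chain_extends_to_maxchain[of "P \<inter> {..u}" "{}"] by (auto simp: chain_less_iff)
  have fin: "finite C" "finite D"
    using C assms(4) by (auto simp: maxchain_less_iff chain_less_iff intro: finite_subset[OF _ finite_P])
  have uC: "u \<in> C" and C_sub: "C \<subseteq> P \<inter> {..u}"
    and C_max: "\<And>x. x \<in> P \<Longrightarrow> x \<le> u \<Longrightarrow> \<forall>c\<in>C. x \<le> c \<or> c \<le> x \<Longrightarrow> x \<in> C"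
    using C assms(1) by (auto simp: maxchain_less_iff chain_less_iff)
  have D_sub: "D \<subseteq> P \<inter> {u..w}"
    using assms(4) by (simp add: maxchain_less_iff chain_less_iff)
  have D_max: "\<And>x. x \<in> P \<Longrightarrow> u \<le> x \<Longrightarrow> x \<le> w \<Longrightarrow> \<forall>c\<in>D. x \<le> c \<or> c \<le> x \<Longrightarrow> x \<in> D"
    using assms(4) by (auto simp: maxchain_less_iff)
  have uD: "u \<in> D"
    using D_sub assms by (intro D_max) auto
  have "pred_on.chain (P \<inter> {..w}) (<) (C \<union> D)"
    unfolding chain_less_iff
  proof (intro conjI ballI)
    show "C \<union> D \<subseteq> P \<inter> {..w}"
      using C_sub D_sub assms(3) by auto
    fix x y assume "x \<in> C \<union> D" "y \<in> C \<union> D"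
    moreover have "x \<le> y" if "x \<in> C" "y \<in> D" for x y
      using subsetD[OF C_sub that(1)] subsetD[OF D_sub that(2)] by auto
    ultimately show "x \<le> y \<or> y \<le> x"
      using C assms(4) by (auto simp: maxchain_less_iff chain_less_iff)
  qed
  moreover have "x \<in> C \<union> D" if x: "x \<in> P \<inter> {..w}" "\<forall>c\<in>C \<union> D. x \<le> c \<or> c \<le> x" for x
  proof (cases "x \<le> u")
    case True
    then show ?thesis
      using x C_max by blast
  next
    case False
    then have "u \<le> x"
      using x(2) uC by blast
    then show ?thesis
      using x D_max by blast
  qed
  ultimately have "pred_on.maxchain (P \<inter> {..w}) (<) (C \<union> D)"
    unfolding maxchain_less_iff by blast
  then have "card (C \<union> D) = Suc (rk P w)"
    using assms(2) by (rule card_maxchain_below[rotated])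
  moreover have "C \<inter> D = {u}"
  proof (intro equalityI subsetI)
    fix x assume "x \<in> C \<inter> D"
    then have "x \<le> u" "u \<le> x"
      using C_sub D_sub by auto
    then show "x \<in> {u}"
      by simp
  qed (use uC uD in simp)
  moreover have "card C = Suc (rk P u)"
    using assms(1) C by (rule card_maxchain_below)
  ultimately show ?thesis
    using card_Un_Int[OF fin] by simp
qed

lemma rk_less:
  assumes "u \<in> P" "w \<in> P" "u < w"
  shows "rk P u < rk P w"
proof -
  have "pred_on.chain (P \<inter> {u..w}) (<) {u, w}"
    using assms by (auto simp: chain_less_iff)
  then obtain D where D: "pred_on.maxchain (P \<inter> {u..w}) (<) D" "{u, w} \<subseteq> D"
    using chain_extends_to_maxchain[of "P \<inter> {u..w}" "{u, w}"] finite_P by (metis finite_Int)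
  have "finite D"
    using D(1) by (auto simp: maxchain_less_iff chain_less_iff intro: finite_subset[OF _ finite_P])
  then have "card {u, w} \<le> card D"
    using D(2) by (rule card_mono)
  then show ?thesis
    using card_maxchain_interval[OF assms(1,2) less_imp_le[OF assms(3)] D(1)] assms(3) by simp
qed

lemma rk_mono: "u \<in> P \<Longrightarrow> w \<in> P \<Longrightarrow> u \<le> w \<Longrightarrow> rk P u \<le> rk P w"
  using rk_less by (fastforce simp: le_less)

lemma rk_eq_imp_eq:
  "u \<in> P \<Longrightarrow> w \<in> P \<Longrightarrow> u \<le> w \<or> w \<le> u \<Longrightarrow> rk P u = rk P w \<Longrightarrow> u = w"
  using rk_less[of u w] rk_less[of w u] by (auto simp: le_less)

lemma rk_interval:
  assumes "u \<in> P" "x \<in> P" "u \<le> x" "x \<le> w"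
  shows "rk (P \<inter> {u..w}) x = rk P x - rk P u"
proof -
  have "P \<inter> {u..w} \<inter> {..x} = P \<inter> {u..x}"
    using assms(4) by auto
  moreover obtain D where D: "pred_on.maxchain (P \<inter> {u..x}) (<) D"
    using chain_extends_to_maxchain[of "P \<inter> {u..x}" "{}"] by (auto simp: chain_less_iff)
  ultimately show ?thesis
    unfolding rk_def[of "P \<inter> {u..w}"]
  proof (intro the_equality)
    have "card D + rk P u = Suc (rk P x)"
      using assms D by (intro card_maxchain_interval)
    then have "card D = Suc (rk P x - rk P u)"
      using rk_mono[OF assms(1,2,3)] by simp
    then show "\<exists>C. pred_on.maxchain (P \<inter> {u..w} \<inter> {..x}) (<) C \<and> card C = Suc (rk P x - rk P u)"
      using D \<open>P \<inter> {u..w} \<inter> {..x} = P \<inter> {u..x}\<close> by auto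
    fix r assume "\<exists>C. pred_on.maxchain (P \<inter> {u..w} \<inter> {..x}) (<) C \<and> card C = Suc r"
    then obtain C where "pred_on.maxchain (P \<inter> {u..x}) (<) C" "card C = Suc r"
      using \<open>P \<inter> {u..w} \<inter> {..x} = P \<inter> {u..x}\<close> by auto
    then have "Suc r + rk P u = Suc (rk P x)"
      using card_maxchain_interval[OF assms(1,2,3)] by metis
    then show "r = rk P x - rk P u"
      by simp
  qed
qed

lemma rk_bot [simp]: "rk P (poset_bot P) = 0"
proof -
  have "P \<inter> {..poset_bot P} = {poset_bot P}"
    using bot_le by (auto intro: order_antisym)
  then have "pred_on.maxchain (P \<inter> {..poset_bot P}) (<) {poset_bot P}"
    by (auto simp: maxchain_less_iff chain_less_iff)
  then show ?thesis
    using card_maxchain_below[OF bot_in] by fastforce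
qed

lemma rk_less_rank: "w \<in> P \<Longrightarrow> w \<noteq> poset_top P \<Longrightarrow> rk P w < poset_rank P"
  unfolding poset_rank_def using rk_less[of w "poset_top P"] le_top[of w] by (auto simp: le_less)

lemma rk_le_rank: "w \<in> P \<Longrightarrow> rk P w \<le> poset_rank P"
  unfolding poset_rank_def using rk_mono[of w "poset_top P"] le_top by simp

text \<open>
  The rank is injective on a chain, so the correct number of elements forces every rank to occur.
\<close>

lemma maxchain_ranks:
  assumes "pred_on.maxchain P (<) M"
  shows "rk P ` M = {0..poset_rank P}"
proof (rule card_subset_eq)
  have M: "M \<subseteq> P" "\<And>x y. x \<in> M \<Longrightarrow> y \<in> M \<Longrightarrow> x \<le> y \<or> y \<le> x"
    using assms by (auto simp: maxchain_less_iff chain_less_iff)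
  show "rk P ` M \<subseteq> {0..poset_rank P}"
    using M(1) rk_le_rank by auto
  have "inj_on (rk P) M"
    using M rk_eq_imp_eq by (intro inj_onI) blast
  moreover have "P \<inter> {..poset_top P} = P"
    using le_top by auto
  ultimately show "card (rk P ` M) = card {0..poset_rank P}"
    using card_maxchain_below[OF top_in] assms by (simp add: card_image poset_rank_def)
qed simp

section \<open>Moebius inversion and Poincare polynomials of intervals\<close>

lemma interval_sum_swap:
  "(\<Sum>v\<in>P \<inter> {u..w}. \<Sum>x\<in>P \<inter> {v..w}. h v x) = (\<Sum>x\<in>P \<inter> {u..w}. \<Sum>v\<in>P \<inter> {u..x}. h v x)"
proof -
  have "(\<Sum>v\<in>P \<inter> {u..w}. \<Sum>x\<in>P \<inter> {v..w}. h v x)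
      = (\<Sum>v\<in>P \<inter> {u..w}. \<Sum>x | x \<in> P \<inter> {u..w} \<and> v \<le> x. h v x)"
    by (intro sum.cong) auto
  also have "\<dots> = (\<Sum>x\<in>P \<inter> {u..w}. \<Sum>v | v \<in> P \<inter> {u..w} \<and> v \<le> x. h v x)"
    by (rule sum.swap_restrict) auto
  also have "\<dots> = (\<Sum>x\<in>P \<inter> {u..w}. \<Sum>v\<in>P \<inter> {u..x}. h v x)"
    by (intro sum.cong) auto
  finally show ?thesis .
qed

lemma sum_mobius_right:
  assumes "u \<in> P" "w \<in> P" "u \<le> w"
  shows "(\<Sum>v\<in>P \<inter> {u..w}. mobius P u v) = (if u = w then 1 else 0)"
proof (cases "u = w")
  case True
  then have "P \<inter> {u..w} = {u}"
    using assms by auto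
  then show ?thesis
    using True by (simp add: mobius.simps)
next
  case False
  then have "P \<inter> {u..w} = insert w (P \<inter> {u..<w})"
    using assms by auto
  then show ?thesis
    using False assms by (simp add: mobius.simps[of P u w])
qed

text \<open>
  The defining recursion only says that \<open>\<mu>\<close> is an inverse of the zeta function on one side. Let
  \<open>f(x)\<close> be the sum of \<open>\<mu>(v, x)\<close> over \<open>v\<close> in \<open>[u, x]\<close>; summing \<open>f(x)\<close> over \<open>x\<close> in
  \<open>[u, w]\<close> and exchanging the sums gives \<open>1\<close> by the recursion. By induction the terms \<open>x < w\<close> contribute \<open>f(u) = 1\<close> already if \<open>u < w\<close>, so
  \<open>f(w) = 0\<close>.
\<close>

lemma sum_mobius_left:
  assumes "u \<in> P" "w \<in> P" "u \<le> w"
  shows "(\<Sum>v\<in>P \<inter> {u..w}. mobius P v w) = (if u = w then 1 else 0)"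
  using assms(2,3)
proof (induction "rk P w" arbitrary: w rule: less_induct)
  case less
  let ?f = "\<lambda>x. \<Sum>v\<in>P \<inter> {u..x}. mobius P v x"
  show ?case
  proof (cases "u = w")
    case True
    then have "P \<inter> {u..w} = {u}"
      using assms by auto
    then show ?thesis
      using True by (simp add: mobius.simps)
  next
    case False
    have "sum ?f (P \<inter> {u..w}) = (\<Sum>v\<in>P \<inter> {u..w}. \<Sum>x\<in>P \<inter> {v..w}. mobius P v x)"
      by (rule interval_sum_swap[symmetric])
    also have "\<dots> = (\<Sum>v\<in>P \<inter> {u..w}. if v = w then 1 else 0)"
      using less.prems by (intro sum.cong) (auto simp: sum_mobius_right)
    also have "\<dots> = 1"
      using less.prems by simp
    finally have "sum ?f (P \<inter> {u..w}) = 1" .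
    moreover have "P \<inter> {u..w} = insert w (P \<inter> {u..<w})"
      using less.prems by auto
    ultimately have "?f w + sum ?f (P \<inter> {u..<w}) = 1"
      by simp
    also have "sum ?f (P \<inter> {u..<w}) = (\<Sum>x\<in>P \<inter> {u..<w}. if u = x then 1 else 0)"
      using less.prems rk_less by (intro sum.cong less.hyps) auto
    also have "\<dots> = 1"
      using False assms less.prems by simp
    finally show ?thesis
      using False by simp
  qed
qed

lemma mobius_interval:
  "u \<in> P \<Longrightarrow> v \<le> w \<Longrightarrow> v \<in> P \<Longrightarrow> mobius (P \<inter> {u..w}) u v = mobius P u v"
proof (induction "rk P v" arbitrary: v rule: less_induct)
  case less
  have "P \<inter> {u..w} \<inter> {u..<v} = P \<inter> {u..<v}"
    using less.prems by auto
  moreover have "mobius (P \<inter> {u..w}) u x = mobius P u x" if "x \<in> P \<inter> {u..<v}" for x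
    using that less.prems rk_less by (intro less.hyps) auto
  ultimately show ?case
    by (subst (1 2) mobius.simps) simp
qed

lemma Poin_interval:
  assumes "u \<in> P" "u \<le> w"
  shows "Poin (P \<inter> {u..w}) =
    (\<Sum>v\<in>P \<inter> {u..w}. smult (mobius P u v) ((- [:0, 1:]) ^ (rk P v - rk P u)))"
proof -
  have "poset_bot (P \<inter> {u..w}) = u"
    unfolding poset_bot_def using assms by (intro Least_equality) auto
  then show ?thesis
    unfolding Poin_def using assms
    by (intro sum.cong) (auto simp: mobius_interval rk_interval)
qed

text \<open>
  After exchanging the sums, the coefficient of \<open>(-y)\<^bsup>rk x - rk u\<^esup>\<close> is the sum of
  \<open>\<mu>(v, x)\<close> over \<open>v\<close> in \<open>[u, x]\<close>, which vanishes unless \<open>x = u\<close>.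
\<close>

lemma sum_Poin_upper_intervals:
  assumes "u \<in> P" "w \<in> P" "u \<le> w"
  shows "(\<Sum>v\<in>P \<inter> {u..w}. (- [:0, 1:]) ^ (rk P v - rk P u) * Poin (P \<inter> {v..w})) = 1"
proof -
  let ?y = "- [:0, 1:] :: int poly"
  have "(\<Sum>v\<in>P \<inter> {u..w}. ?y ^ (rk P v - rk P u) * Poin (P \<inter> {v..w}))
      = (\<Sum>v\<in>P \<inter> {u..w}. \<Sum>x\<in>P \<inter> {v..w}. smult (mobius P v x) (?y ^ (rk P x - rk P u)))"
  proof (rule sum.cong[OF refl])
    fix v assume v: "v \<in> P \<inter> {u..w}"
    have "?y ^ (rk P v - rk P u) * ?y ^ (rk P x - rk P v) = ?y ^ (rk P x - rk P u)"
      if "x \<in> P \<inter> {v..w}" for x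
      using that v assms rk_mono[of u v] rk_mono[of v x] by (simp flip: power_add)
    then show "?y ^ (rk P v - rk P u) * Poin (P \<inter> {v..w})
        = (\<Sum>x\<in>P \<inter> {v..w}. smult (mobius P v x) (?y ^ (rk P x - rk P u)))"
      using v by (simp add: Poin_interval sum_distrib_left del: mult_minus_left)
  qed
  also have "\<dots> = (\<Sum>x\<in>P \<inter> {u..w}. smult (\<Sum>v\<in>P \<inter> {u..x}. mobius P v x) (?y ^ (rk P x - rk P u)))"
    unfolding interval_sum_swap by (simp add: smult_sum)
  also have "\<dots> = (\<Sum>x\<in>P \<inter> {u..w}. if x = u then 1 else 0)"
    using assms(1) by (intro sum.cong) (auto simp: sum_mobius_left)
  also have "\<dots> = 1"
    using assms by simp
  finally show ?thesis .
qed

section \<open>Sums over chains with a given least element\<close>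

abbreviation height :: nat where
  "height \<equiv> poset_rank P"

abbreviation top_elem :: 'a where
  "top_elem \<equiv> poset_top P"

definition rank_set :: "'a set \<Rightarrow> nat set" where
  "rank_set C = rk P ` (C - {top_elem})"

definition chains_from :: "'a \<Rightarrow> 'a set set" where
  "chains_from u = {C \<in> top_chains P. u \<in> C \<and> (\<forall>c\<in>C. u \<le> c)}"

lemma top_chains_iff:
  "C \<in> top_chains P \<longleftrightarrow> C \<subseteq> P \<and> (\<forall>x\<in>C. \<forall>y\<in>C. x \<le> y \<or> y \<le> x) \<and> top_elem \<in> C"
  by (auto simp: top_chains_def chain_less_iff)

lemma finite_top_chains [simp]: "finite (top_chains P)"
  by (rule finite_subset[of _ "Pow P"]) (auto simp: top_chains_iff)

lemma finite_chains_from [simp]: "finite (chains_from u)"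
  by (simp add: chains_from_def)

lemma chains_fromD:
  assumes "C \<in> chains_from u"
  shows "C \<in> top_chains P" "u \<in> C" "u \<in> P" "C \<subseteq> P" "top_elem \<in> C"
    "\<And>c. c \<in> C \<Longrightarrow> u \<le> c" "finite C"
    "\<And>x y. x \<in> C \<Longrightarrow> y \<in> C \<Longrightarrow> x \<le> y \<or> y \<le> x"
  using assms by (auto simp: chains_from_def top_chains_iff intro: finite_subset[OF _ finite_P])

lemma rank_set_subset: "C \<in> top_chains P \<Longrightarrow> rank_set C \<subseteq> {0..<height}"
  unfolding rank_set_def top_chains_iff using rk_less_rank by fastforce

lemma chains_from_disjoint: "u \<noteq> v \<Longrightarrow> chains_from u \<inter> chains_from v = {}"
  using order_antisym unfolding chains_from_def by blast

lemma sum_top_chains: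
  "(\<Sum>C\<in>top_chains P. f C) = (\<Sum>u\<in>P. \<Sum>C\<in>chains_from u. f C)"
proof -
  have "C \<in> (\<Union>u\<in>P. chains_from u)" if C: "C \<in> top_chains P" for C
  proof -
    have "finite C" "C \<noteq> {}"
      using C by (auto simp: top_chains_iff intro: finite_subset[OF _ finite_P])
    then obtain u where "u \<in> C" "\<forall>c\<in>C. c \<le> u \<longrightarrow> u = c"
      using finite_has_minimal by metis
    then have "C \<in> chains_from u" "u \<in> P"
      using C by (auto simp: chains_from_def top_chains_iff)
    then show ?thesis
      by blast
  qed
  then have "top_chains P = (\<Union>u\<in>P. chains_from u)"
    by (auto simp: chains_from_def)
  then show ?thesis
    by (simp add: sum.UNION_disjoint chains_from_disjoint)
qed

lemma chains_from_top: "chains_from top_elem = {{top_elem}}"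
proof -
  have "c = top_elem" if "C \<subseteq> P" "\<forall>c\<in>C. top_elem \<le> c" "c \<in> C" for C c
    using that le_top[of c] by (auto intro: order_antisym)
  then show ?thesis
    by (auto simp: chains_from_def top_chains_iff)
qed

text \<open>
  Removing \<open>u\<close> from a chain with least element \<open>u\<close> leaves a chain with a larger least element.
\<close>

lemma sum_chains_from:
  assumes "u \<in> P" "u \<noteq> top_elem"
  shows "(\<Sum>C\<in>chains_from u. f C) = (\<Sum>v\<in>P \<inter> {u<..}. \<Sum>C\<in>chains_from v. f (insert u C))"
proof -
  let ?U = "\<Union>v\<in>P \<inter> {u<..}. chains_from v"
  have "chains_from u = insert u ` ?U"
  proof (intro equalityI subsetI)
    fix C assume C: "C \<in> chains_from u"
    let ?D = "C - {u}"
    have "finite ?D" "?D \<noteq> {}"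
      using chains_fromD[OF C] assms by auto
    then obtain v where v: "v \<in> ?D" "\<forall>c\<in>?D. c \<le> v \<longrightarrow> v = c"
      using finite_has_minimal by metis
    have "v \<le> c" if "c \<in> ?D" for c
      using v that chains_fromD(8)[OF C, of v c] by auto
    then have "?D \<in> chains_from v"
      using v chains_fromD[OF C] assms(2) by (auto simp: chains_from_def top_chains_iff)
    moreover have "v \<in> P \<inter> {u<..}"
      using v chains_fromD[OF C] by (auto simp: less_le)
    ultimately have "?D \<in> ?U"
      by blast
    moreover have "C = insert u ?D"
      using chains_fromD(2)[OF C] by blast
    ultimately show "C \<in> insert u ` ?U"
      by blast
  next
    fix C assume "C \<in> insert u ` ?U"
    then obtain v D where D: "v \<in> P" "u < v" "D \<in> chains_from v" "C = insert u D"
      by auto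
    have "u \<le> c" if "c \<in> D" for c
      using chains_fromD(6)[OF D(3) that] D(2) by simp
    then show "C \<in> chains_from u"
      using D assms chains_fromD[OF D(3)] by (auto simp: chains_from_def top_chains_iff)
  qed
  then have "(\<Sum>C\<in>chains_from u. f C) = sum f (insert u ` ?U)"
    by simp
  also have "\<dots> = (\<Sum>C\<in>?U. f (insert u C))"
  proof (rule sum.reindex_cong[OF _ refl refl])
    have "u \<notin> C" if "C \<in> ?U" for C
      using that chains_fromD(6)[of C _ u] by (auto simp: less_le_not_le)
    then show "inj_on (insert u) ?U"
      by (meson inj_onI insert_ident)
  qed
  also have "\<dots> = (\<Sum>v\<in>P \<inter> {u<..}. \<Sum>C\<in>chains_from v. f (insert u C))"
    by (rule sum.UNION_disjoint) (simp_all add: chains_from_disjoint)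
  finally show ?thesis .
qed

lemma Poin_chain_insert:
  assumes "u < v" "C \<in> chains_from v"
  shows "Poin_chain P (insert u C) = Poin (P \<inter> {u..v}) * Poin_chain P C"
proof -
  note C = chains_fromD[OF assms(2)]
  have u: "u \<notin> C"
    using C(6) assms(1) by (auto simp: less_le_not_le)
  have "chain_next (insert u C) u = v"
    unfolding chain_next_def using C assms(1) by (intro Least_equality) auto
  moreover have "chain_next (insert u C) c = chain_next C c" if "c \<in> C" for c
  proof -
    have "d \<in> insert u C \<and> c < d \<longleftrightarrow> d \<in> C \<and> c < d" for d
      using C(6)[OF that] assms(1) by (auto simp: less_le_not_le)
    then show ?thesis
      by (simp add: chain_next_def)
  qed
  moreover have "insert u C - {top_elem} = insert u (C - {top_elem})"
    using u C(5) by auto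
  ultimately show ?thesis
    using u C(7) by (simp add: Poin_chain_def)
qed

lemma rank_word_insert:
  assumes "u \<in> P" "u < v" "C \<in> chains_from v"
  shows "segment_word (rank_set (insert u C)) (rk P u) height =
    Lb # replicate (rk P v - rk P u - 1) La @ segment_word (rank_set C) (rk P v) height"
proof -
  note C = chains_fromD[OF assms(3)]
  have uv: "rk P u < rk P v" "rk P v \<le> height"
    using assms C rk_less rk_le_rank by auto
  have "u \<noteq> top_elem"
    using assms(2) le_top[OF C(3)] by auto
  then have ranks: "rank_set (insert u C) = insert (rk P u) (rank_set C)"
    by (auto simp: rank_set_def)
  have ge: "rk P v \<le> r" if "r \<in> rank_set C" for r
    using that C(3,4,6) by (auto simp: rank_set_def intro!: rk_mono)
  have "segment_word (rank_set (insert u C)) (rk P u) height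
      = Lb # segment_word (insert (rk P u) (rank_set C)) (Suc (rk P u)) height"
    using uv by (subst segment_word_rec) (simp_all add: ranks)
  also have "segment_word (insert (rk P u) (rank_set C)) (Suc (rk P u)) height
      = segment_word (rank_set C) (Suc (rk P u)) height"
    by (rule segment_word_cong) auto
  also have "\<dots> = replicate (rk P v - Suc (rk P u)) La @ segment_word (rank_set C) (rk P v) height"
    using uv ge by (intro segment_word_gap) fastforce+
  finally show ?thesis
    by simp
qed

lemma rank_word_from:
  assumes "C \<in> chains_from u"
  shows "segment_word (rank_set C) 0 height =
    replicate (rk P u) La @ segment_word (rank_set C) (rk P u) height"
proof -
  note C = chains_fromD[OF assms]
  have "rk P u \<le> r" if "r \<in> rank_set C" for r
    using that C(3,4,6) by (auto simp: rank_set_def intro!: rk_mono)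
  then show ?thesis
    using segment_word_gap[of 0 "rk P u" height "rank_set C"] rk_le_rank[OF C(3)] by fastforce
qed

text \<open>
  The contributions of the chains with least element \<open>u\<close>, with only the letters from rank \<open>rk u\<close> on:
  \<open>chain_sum\<close> to the extended \<open>ab\<close>-index, \<open>free_sum\<close> and \<open>tied_sum\<close> to the two entries
  of the matrix weights. If \<open>u\<close> is not the maximum, they turn out to be multiples of \<open>chain_step u\<close> and
  \<open>flag_step u\<close>, from which the letter at the rank of \<open>u\<close> has been split off.
\<close>

definition chain_sum :: "'a \<Rightarrow> ab_poly" where
  "chain_sum u = (\<Sum>C\<in>chains_from u.
     ab_const (Poin_chain P C) * word_wt (segment_word (rank_set C) (rk P u) height))"

definition free_sum :: "'a \<Rightarrow> ab_poly" where
  "free_sum u = (\<Sum>C\<in>chains_from u. free_wt (segment_word (rank_set C) (rk P u) height))"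

definition tied_sum :: "'a \<Rightarrow> ab_poly" where
  "tied_sum u = (\<Sum>C\<in>chains_from u. tied_wt (segment_word (rank_set C) (rk P u) height))"

definition chain_step :: "'a \<Rightarrow> ab_poly" where
  "chain_step u = (\<Sum>v\<in>P \<inter> {u<..}. ab_const (Poin (P \<inter> {u..v})) *
     ((var_a - var_b) ^ (rk P v - rk P u - 1) * chain_sum v))"

lemma sums_at_top: "chain_sum top_elem = 1" "free_sum top_elem = 1" "tied_sum top_elem = - 1"
  by (simp_all add: chain_sum_def free_sum_def tied_sum_def chains_from_top rank_set_def
      Poin_chain_def flip: poset_rank_def)

lemma chain_sum_rec:
  assumes "u \<in> P" "u \<noteq> top_elem"
  shows "chain_sum u = var_b * chain_step u"
proof -
  have "chain_sum u = (\<Sum>v\<in>P \<inter> {u<..}. \<Sum>C\<in>chains_from v. var_b * (ab_const (Poin (P \<inter> {u..v})) *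
      ((var_a - var_b) ^ (rk P v - rk P u - 1) *
        (ab_const (Poin_chain P C) * word_wt (segment_word (rank_set C) (rk P v) height)))))"
    unfolding chain_sum_def sum_chains_from[OF assms]
  proof (intro sum.cong refl)
    fix v C assume v: "v \<in> P \<inter> {u<..}" and C: "C \<in> chains_from v"
    let ?d = "(var_a - var_b) ^ (rk P v - rk P u - 1)"
    let ?w = "word_wt (segment_word (rank_set C) (rk P v) height)"
    have "ab_const (Poin_chain P (insert u C)) *
        word_wt (segment_word (rank_set (insert u C)) (rk P u) height)
        = ab_const (Poin (P \<inter> {u..v})) * (ab_const (Poin_chain P C) * (var_b * (?d * ?w)))"
      using v Poin_chain_insert[OF _ C, of u] rank_word_insert[OF assms(1) _ C]
      by (simp add: word_wt_gap ab_const_mult mult.assoc)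
    also have "\<dots> = var_b * (ab_const (Poin (P \<inter> {u..v})) * (?d * (ab_const (Poin_chain P C) * ?w)))"
      by (simp only: ab_const_left_commute[of var_b] ab_const_left_commute[of ?d]
          ab_const_left_commute[of "ab_const (Poin_chain P C)"])
    finally show "ab_const (Poin_chain P (insert u C)) *
        word_wt (segment_word (rank_set (insert u C)) (rk P u) height)
        = var_b * (ab_const (Poin (P \<inter> {u..v})) * (?d * (ab_const (Poin_chain P C) * ?w)))" .
  qed
  then show ?thesis
    by (simp add: chain_step_def chain_sum_def sum_distrib_left)
qed

definition flag_step :: "'a \<Rightarrow> ab_poly" where
  "flag_step u = (\<Sum>v\<in>P \<inter> {u<..}. (var_a - var_b) ^ (rk P v - rk P u - 1) * free_sum v +
     (- var_y) ^ (rk P v - rk P u) * ((var_a - var_b) ^ (rk P v - rk P u - 1) * tied_sum v))"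

lemma flag_sums_rec:
  assumes "u \<in> P" "u \<noteq> top_elem"
  shows "free_sum u = var_b * flag_step u" "tied_sum u = - var_a * flag_step u"
proof -
  let ?tail = "\<lambda>v C. segment_word (rank_set C) (rk P v) height"
  let ?rest = "\<lambda>v C. (var_a - var_b) ^ (rk P v - rk P u - 1) * free_wt (?tail v C) +
     (- var_y) ^ (rk P v - rk P u) * ((var_a - var_b) ^ (rk P v - rk P u - 1) * tied_wt (?tail v C))"
  have rest: "free_wt w - var_y * tied_wt w = ?rest v C"
    if "w = replicate (rk P v - rk P u - 1) La @ ?tail v C" "v \<in> P \<inter> {u<..}" for v C w
  proof -
    have "rk P v - rk P u = Suc (rk P v - rk P u - 1)"
      using rk_less[of u v] assms that(2) by auto
    then have "(- var_y) ^ (rk P v - rk P u) = - (var_y * (- var_y) ^ (rk P v - rk P u - 1))"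
      by (metis mult_minus_left power_Suc)
    then show ?thesis
      by (simp add: that(1) free_wt_gap tied_wt_gap mult.assoc)
  qed
  have step: "flag_step u = (\<Sum>v\<in>P \<inter> {u<..}. \<Sum>C\<in>chains_from v. ?rest v C)"
    by (simp add: flag_step_def free_sum_def tied_sum_def sum_distrib_left sum.distrib)
  show "free_sum u = var_b * flag_step u" "tied_sum u = - var_a * flag_step u"
    unfolding step free_sum_def tied_sum_def sum_chains_from[OF assms] sum_distrib_left
    using assms by (auto intro!: sum.cong simp: rank_word_insert rest simp del: One_nat_def)
qed

lemma sum_Poin_half_open:
  assumes "u \<in> P" "x \<in> P" "u < x"
  shows "(\<Sum>v\<in>P \<inter> {u<..x}. (- [:0, 1:]) ^ (rk P v - rk P u) * Poin (P \<inter> {v..x}))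
    = 1 - Poin (P \<inter> {u..x})"
proof -
  have "P \<inter> {u..x} = insert u (P \<inter> {u<..x})"
    using assms by auto
  then show ?thesis
    using sum_Poin_upper_intervals[of u x] assms by (simp add: algebra_simps)
qed

lemma Poin_singleton: "u \<in> P \<Longrightarrow> Poin {u} = 1"
proof -
  assume "u \<in> P"
  moreover from this have "P \<inter> {u..u} = {u}"
    by auto
  ultimately show ?thesis
    using Poin_interval[of u u] by (simp add: mobius.simps)
qed

text \<open>
  In the tied state at \<open>u\<close> a Hall chain is still open; closing it in all possible ways produces
  the Poincare polynomial of the interval up to the next element \<open>v \<ge> u\<close> of the original chain,
  with a minus sign. That \<open>free_sum\<close> and \<open>chain_sum\<close> agree amounts to \<open>flag_step u = chain_step u\<close>:
  after inserting the formula for \<open>tied_sum\<close> into \<open>flag_step u\<close>, the coefficient of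
  \<open>d\<^bsup>rk x - rk u - 1\<^esup> chain_sum x\<close> is \<open>1\<close> minus the sum over \<open>u < v \<le> x\<close> in
  \<open>sum_Poin_half_open\<close>, that is, \<open>Poin [u, x]\<close>. The formula for \<open>tied_sum u\<close> is recovered from
  \<open>b + d = a\<close>.
\<close>

lemma flag_sums_eq:
  assumes "u \<in> P"
  shows "free_sum u = chain_sum u \<and>
    tied_sum u = - (\<Sum>v\<in>P \<inter> {u..}. ab_const (Poin (P \<inter> {u..v})) *
      ((var_a - var_b) ^ (rk P v - rk P u) * chain_sum v))"
  using assms
proof (induction "height - rk P u" arbitrary: u rule: less_induct)
  case less
  show ?case
  proof (cases "u = top_elem")
    case True
    then have "P \<inter> {u..} = {u}"
      using less.prems le_top by (auto intro: order_antisym)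
    then show ?thesis
      using True less.prems by (simp add: sums_at_top Poin_singleton)
  next
    case False
    let ?d = "var_a - var_b"
    let ?r = "\<lambda>v. rk P v - rk P u"
    let ?Y = "\<lambda>v. (- [:0, 1:] :: int poly) ^ ?r v"
    have rk_pos: "rk P u < rk P v" if "v \<in> P \<inter> {u<..}" for v
      using that rk_less less.prems by auto
    have IH: "free_sum v = chain_sum v"
      "tied_sum v = - (\<Sum>x\<in>P \<inter> {v..}. ab_const (Poin (P \<inter> {v..x})) *
        (?d ^ (rk P x - rk P v) * chain_sum x))" if "v \<in> P \<inter> {u<..}" for v
      using less.hyps[of v] rk_pos[OF that] rk_le_rank[of v] that by auto
    have tied: "(- var_y) ^ ?r v * (?d ^ (?r v - 1) * tied_sum v)
        = - (\<Sum>x\<in>P \<inter> {v..}. ab_const (?Y v * Poin (P \<inter> {v..x})) * (?d ^ (?r x - 1) * chain_sum x))"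
      if v: "v \<in> P \<inter> {u<..}" for v
    proof -
      have "(- var_y) ^ ?r v * (?d ^ (?r v - 1) *
            (ab_const (Poin (P \<inter> {v..x})) * (?d ^ (rk P x - rk P v) * chain_sum x)))
          = ab_const (?Y v * Poin (P \<inter> {v..x})) * (?d ^ (?r x - 1) * chain_sum x)"
        if x: "x \<in> P \<inter> {v..}" for x
      proof -
        have "?r x - 1 = (?r v - 1) + (rk P x - rk P v)"
          using rk_pos[OF v] rk_mono[of v x] v x by auto
        then have "?d ^ (?r x - 1) = ?d ^ (?r v - 1) * ?d ^ (rk P x - rk P v)"
          by (simp only: power_add)
        moreover have "(- var_y) ^ ?r v = ab_const (?Y v)"
          by (simp only: ab_const_neg_y_power)
        ultimately show ?thesis
          by (simp only: ab_const_mult mult.assoc ab_const_left_commute[of "?d ^ (?r v - 1)"])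
      qed
      then show ?thesis
        by (simp add: IH(2)[OF v] sum_distrib_left del: One_nat_def)
    qed
    have "flag_step u = (\<Sum>v\<in>P \<inter> {u<..}. ?d ^ (?r v - 1) * chain_sum v)
        - (\<Sum>v\<in>P \<inter> {u<..}. \<Sum>x\<in>P \<inter> {v..}.
            ab_const (?Y v * Poin (P \<inter> {v..x})) * (?d ^ (?r x - 1) * chain_sum x))"
      unfolding flag_step_def sum_subtractf[symmetric]
      by (intro sum.cong refl) (simp only: tied IH(1) add_uminus_conv_diff)
    also have "(\<Sum>v\<in>P \<inter> {u<..}. \<Sum>x\<in>P \<inter> {v..}.
            ab_const (?Y v * Poin (P \<inter> {v..x})) * (?d ^ (?r x - 1) * chain_sum x))
        = (\<Sum>v\<in>P \<inter> {u<..}. \<Sum>x | x \<in> P \<inter> {u<..} \<and> v \<le> x.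
            ab_const (?Y v * Poin (P \<inter> {v..x})) * (?d ^ (?r x - 1) * chain_sum x))"
      by (intro sum.cong) auto
    also have "\<dots> = (\<Sum>x\<in>P \<inter> {u<..}. \<Sum>v | v \<in> P \<inter> {u<..} \<and> v \<le> x.
            ab_const (?Y v * Poin (P \<inter> {v..x})) * (?d ^ (?r x - 1) * chain_sum x))"
      by (rule sum.swap_restrict) auto
    also have "\<dots> = (\<Sum>x\<in>P \<inter> {u<..}.
            ab_const (\<Sum>v\<in>P \<inter> {u<..x}. ?Y v * Poin (P \<inter> {v..x})) * (?d ^ (?r x - 1) * chain_sum x))"
      unfolding ab_const_sum sum_distrib_right by (intro sum.cong) auto
    also have "\<dots> = (\<Sum>x\<in>P \<inter> {u<..}.
            ab_const (1 - Poin (P \<inter> {u..x})) * (?d ^ (?r x - 1) * chain_sum x))"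
      using less.prems by (intro sum.cong) (simp_all add: sum_Poin_half_open del: One_nat_def minus_pCons)
    also have "(\<Sum>v\<in>P \<inter> {u<..}. ?d ^ (?r v - 1) * chain_sum v) - \<dots> = chain_step u"
      unfolding chain_step_def sum_subtractf[symmetric]
      by (intro sum.cong refl)
        (simp add: ab_const_diff left_diff_distrib del: One_nat_def)
    finally have step: "flag_step u = chain_step u" .
    have "P \<inter> {u..} = insert u (P \<inter> {u<..})"
      using less.prems by auto
    moreover have "ab_const (Poin (P \<inter> {u..v})) * (?d ^ ?r v * chain_sum v)
        = ?d * (ab_const (Poin (P \<inter> {u..v})) * (?d ^ (?r v - 1) * chain_sum v))"
      if "v \<in> P \<inter> {u<..}" for v
    proof -
      have "?d ^ ?r v = ?d * ?d ^ (?r v - 1)"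
        using rk_pos[OF that] by (metis power_minus_mult power_commutes zero_less_diff)
      then show ?thesis
        by (simp only: mult.assoc ab_const_left_commute[of ?d])
    qed
    ultimately have "(\<Sum>v\<in>P \<inter> {u..}. ab_const (Poin (P \<inter> {u..v})) * (?d ^ ?r v * chain_sum v))
        = chain_sum u + ?d * chain_step u"
      using less.prems by (simp add: Poin_singleton chain_step_def sum_distrib_left del: One_nat_def)
    also have "\<dots> = var_a * chain_step u"
      using chain_sum_rec[OF less.prems False] by (simp add: algebra_simps)
    finally show ?thesis
      using flag_sums_rec[OF less.prems False] chain_sum_rec[OF less.prems False] step by simp
  qed
qed

section \<open>The extended ab-index in terms of the flag vectors\<close>

lemma ex_ab_index_eq_sum_free_wt:
  "ex_ab_index P = (\<Sum>C\<in>top_chains P. free_wt (segment_word (rank_set C) 0 height))"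
proof -
  have "ex_ab_index P = (\<Sum>C\<in>top_chains P.
      ab_const (Poin_chain P C) * word_wt (segment_word (rank_set C) 0 height))"
    by (simp add: ex_ab_index_def wt_chain_def wt_eq rank_set_def)
  also have "\<dots> = (\<Sum>u\<in>P. (var_a - var_b) ^ rk P u * chain_sum u)"
    unfolding sum_top_chains chain_sum_def sum_distrib_left
    by (intro sum.cong refl, subst rank_word_from, assumption)
      (metis word_wt_gap ab_const_commute mult.assoc)
  also have "\<dots> = (\<Sum>u\<in>P. (var_a - var_b) ^ rk P u * free_sum u)"
    by (intro sum.cong) (simp_all add: flag_sums_eq)
  also have "\<dots> = (\<Sum>C\<in>top_chains P. free_wt (segment_word (rank_set C) 0 height))"
    unfolding sum_top_chains free_sum_def sum_distrib_left
    by (intro sum.cong refl, subst rank_word_from, assumption) (simp add: free_wt_gap)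
  finally show ?thesis .
qed

text \<open>
  A maximal chain of the rank-selected subposet meets every rank in \<open>S\<close>: together with the maximum it
  extends to a maximal chain of \<open>P\<close>, whose element of a missing rank could be added. Conversely
  a chain that meets all ranks in \<open>S\<close> is maximal, as comparable elements of equal rank coincide.
\<close>

lemma flag_f_eq:
  assumes "S \<subseteq> {0..<height}"
  shows "flag_f P S = card {C \<in> top_chains P. rank_set C = S}"
proof -
  let ?Q = "{w \<in> P. rk P w \<in> S}"
  have top_notin: "top_elem \<notin> ?Q"
    using assms by (auto simp: poset_rank_def)
  have "bij_betw (insert top_elem) {C. pred_on.maxchain ?Q (<) C} {C \<in> top_chains P. rank_set C = S}"
  proof (rule bij_betwI[where g = "\<lambda>C. C - {top_elem}"])
    show "insert top_elem \<in> {C. pred_on.maxchain ?Q (<) C} \<rightarrow> {C \<in> top_chains P. rank_set C = S}"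
    proof (intro Pi_I CollectI conjI)
      fix C assume "C \<in> {C. pred_on.maxchain ?Q (<) C}"
      then have C: "C \<subseteq> ?Q" "\<And>x y. x \<in> C \<Longrightarrow> y \<in> C \<Longrightarrow> x \<le> y \<or> y \<le> x"
        and max: "\<And>x. x \<in> ?Q \<Longrightarrow> \<forall>c\<in>C. x \<le> c \<or> c \<le> x \<Longrightarrow> x \<in> C"
        by (auto simp: maxchain_less_iff chain_less_iff)
      show chain: "insert top_elem C \<in> top_chains P"
        using C le_top by (auto simp: top_chains_iff)
      obtain M where M: "pred_on.maxchain P (<) M" "insert top_elem C \<subseteq> M"
        using chain_extends_to_maxchain[of P "insert top_elem C"] chain finite_P
        unfolding top_chains_def by blast
      have "S \<subseteq> rk P ` C"
      proof
        fix s assume s: "s \<in> S"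
        then have "s \<in> rk P ` M"
          using assms unfolding maxchain_ranks[OF M(1)] by auto
        then obtain x where x: "x \<in> M" "rk P x = s"
          by blast
        have "x \<in> ?Q" "\<forall>c\<in>C. x \<le> c \<or> c \<le> x"
          using x s M by (auto simp: maxchain_less_iff chain_less_iff)
        then show "s \<in> rk P ` C"
          using max x(2) by blast
      qed
      moreover have "insert top_elem C - {top_elem} = C"
        using C(1) top_notin by auto
      ultimately show "rank_set (insert top_elem C) = S"
        using C(1) by (auto simp: rank_set_def)
    qed
    show "(\<lambda>C. C - {top_elem}) \<in> {C \<in> top_chains P. rank_set C = S} \<rightarrow> {C. pred_on.maxchain ?Q (<) C}"
    proof (intro Pi_I CollectI)
      fix C assume "C \<in> {C \<in> top_chains P. rank_set C = S}"
      then have C: "C \<subseteq> P" "\<And>x y. x \<in> C \<Longrightarrow> y \<in> C \<Longrightarrow> x \<le> y \<or> y \<le> x"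
        "rk P ` (C - {top_elem}) = S"
        by (auto simp: top_chains_iff rank_set_def)
      have "x \<in> C - {top_elem}" if x: "x \<in> ?Q" "\<forall>c\<in>C - {top_elem}. x \<le> c \<or> c \<le> x" for x
      proof -
        have "rk P x \<in> rk P ` (C - {top_elem})"
          using x(1) C(3) by simp
        then obtain c where c: "c \<in> C - {top_elem}" "rk P x = rk P c"
          by blast
        then have "x = c"
          using x C(1) by (intro rk_eq_imp_eq) auto
        with c show ?thesis
          by simp
      qed
      then show "pred_on.maxchain ?Q (<) (C - {top_elem})"
        using C by (auto simp: maxchain_less_iff chain_less_iff)
    qed
    show "insert top_elem C - {top_elem} = C" if "C \<in> {C. pred_on.maxchain ?Q (<) C}" for C
      using that top_notin by (auto simp: maxchain_less_iff chain_less_iff)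
    show "insert top_elem (C - {top_elem}) = C" if "C \<in> {C \<in> top_chains P. rank_set C = S}" for C
      using that by (auto simp: top_chains_iff)
  qed
  then show ?thesis
    unfolding flag_f_def by (rule bij_betw_same_card)
qed

text \<open>
  The minimum is the only element of rank \<open>0\<close> and is comparable with everything.
\<close>

lemma flag_f_insert_0:
  assumes "S \<subseteq> {0..<height}" "0 \<notin> S" "0 < height"
  shows "flag_f P (insert 0 S) = flag_f P S"
proof -
  let ?b = "poset_bot P"
  have b: "?b \<noteq> top_elem"
    using assms(3) rk_bot by (metis less_irrefl poset_rank_def)
  have rk0: "x = ?b" if "x \<in> P" "rk P x = 0" for x
    using that bot_le by (intro rk_eq_imp_eq) auto
  have "bij_betw (insert ?b) {C \<in> top_chains P. rank_set C = S}
    {C \<in> top_chains P. rank_set C = insert 0 S}"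
  proof (rule bij_betwI[where g = "\<lambda>C. C - {?b}"])
    show "insert ?b \<in> {C \<in> top_chains P. rank_set C = S} \<rightarrow>
        {C \<in> top_chains P. rank_set C = insert 0 S}"
      using b bot_le by (auto simp: top_chains_iff rank_set_def insert_Diff_if)
    show "(\<lambda>C. C - {?b}) \<in> {C \<in> top_chains P. rank_set C = insert 0 S} \<rightarrow>
        {C \<in> top_chains P. rank_set C = S}"
    proof (intro Pi_I CollectI conjI)
      fix C assume "C \<in> {C \<in> top_chains P. rank_set C = insert 0 S}"
      then have C: "C \<in> top_chains P" "C \<subseteq> P" "rank_set C = insert 0 S"
        by (auto simp: top_chains_iff)
      show "C - {?b} \<in> top_chains P"
        using C b by (auto simp: top_chains_iff)
      have "rank_set (C - {?b}) = rank_set C - {0}"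
        using C(2) rk0 by (fastforce simp: rank_set_def)
      then show "rank_set (C - {?b}) = S"
        using C(3) assms(2) by simp
    qed
    show "insert ?b C - {?b} = C" if C: "C \<in> {C \<in> top_chains P. rank_set C = S}" for C
    proof -
      have "?b \<notin> C"
        using C assms(2) b rk_bot by (force simp: rank_set_def)
      then show ?thesis
        by simp
    qed
    show "insert ?b (C - {?b}) = C" if C: "C \<in> {C \<in> top_chains P. rank_set C = insert 0 S}" for C
    proof -
      have "0 \<in> rk P ` (C - {top_elem})" "C \<subseteq> P"
        using C by (auto simp: rank_set_def top_chains_iff)
      then obtain c where "c \<in> C" "c \<in> P" "rk P c = 0"
        by (elim imageE) auto
      then have "?b \<in> C"
        using rk0[of c] by simp
      then show ?thesis
        by blast
    qed
  qed
  then show ?thesis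
    using assms by (simp add: flag_f_eq bij_betw_same_card)
qed

text \<open>
  The sets \<open>S\<close> and \<open>S \<union> {0}\<close> contribute the same flag number with opposite signs.
\<close>

lemma flag_h_eq_0:
  assumes "T \<subseteq> {0..<height}" "0 \<in> T"
  shows "flag_h P T = 0"
proof -
  define R where "R = T - {0}"
  have T: "T = insert 0 R" "0 \<notin> R" "finite R"
    using assms finite_subset[of T "{0..<height}"] by (auto simp: R_def)
  let ?t = "\<lambda>S. (- 1) ^ card (T - S) * int (flag_f P S)"
  have inj: "inj_on (insert 0) (Pow R)"
    using T(2) by (meson PowD inj_onI insert_ident subsetD)
  have "flag_h P T = sum ?t (Pow R) + sum ?t (insert 0 ` Pow R)"
    unfolding flag_h_def T(1) Pow_insert using T by (intro sum.union_disjoint) auto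
  also have "sum ?t (insert 0 ` Pow R) = (\<Sum>S\<in>Pow R. ?t (insert 0 S))"
    using inj by (simp add: sum.reindex)
  also have "\<dots> = (\<Sum>S\<in>Pow R. - ?t S)"
  proof (rule sum.cong[OF refl])
    fix S assume S: "S \<in> Pow R"
    then have "T - S = insert 0 (T - insert 0 S)" "finite (T - insert 0 S)"
      using T by auto
    then have "card (T - S) = Suc (card (T - insert 0 S))"
      by (metis Diff_iff card_insert_disjoint insertI1)
    moreover have "flag_f P (insert 0 S) = flag_f P S"
      using S T assms by (intro flag_f_insert_0) auto
    ultimately show "?t (insert 0 S) = - ?t S"
      by simp
  qed
  finally show ?thesis
    by (simp add: sum_negf)
qed

lemma ex_ab_index_eq_sum_flag_f:
  "ex_ab_index P = (\<Sum>S\<in>Pow {0..<height}. of_nat (flag_f P S) * free_wt (segment_word S 0 height))"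
proof -
  have "ex_ab_index P = (\<Sum>S\<in>Pow {0..<height}. \<Sum>C | C \<in> top_chains P \<and> rank_set C = S.
      free_wt (segment_word (rank_set C) 0 height))"
    unfolding ex_ab_index_eq_sum_free_wt
    using rank_set_subset by (intro sum.group[symmetric]) auto
  then show ?thesis
    by (simp add: flag_f_eq)
qed

lemma ex_ab_index_eq_sum_flag_h:
  "ex_ab_index P = (\<Sum>T\<in>Pow {0..<height}. of_int (flag_h P T) * omega (mono_of height T))"
proof -
  let ?N = "{0..<height}"
  let ?m = "\<lambda>T. free_omega (segment_word T 0 height)"
  have disjoint: "U - S = U" if "U \<subseteq> ?N - S" for S U
    using that by blast
  \<comment> \<open>Exchanging the sums over \<open>S\<close> and \<open>T = S \<union> U\<close> collects \<open>\<beta>(T)\<close>.\<close>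
  have "ex_ab_index P = (\<Sum>S\<in>Pow ?N. \<Sum>U\<in>Pow (?N - S).
      of_nat (flag_f P S) * ((- 1) ^ card U * ?m (S \<union> U)))"
    unfolding ex_ab_index_eq_sum_flag_f
    by (simp add: alternating_sum_omega[THEN conjunct1, symmetric] sum_distrib_left)
  also have "\<dots> = (\<Sum>(S, U)\<in>(SIGMA S:Pow ?N. Pow (?N - S)).
      of_nat (flag_f P S) * ((- 1) ^ card U * ?m (S \<union> U)))"
    by (rule sum.Sigma) auto
  also have "\<dots> = (\<Sum>(T, S)\<in>(SIGMA T:Pow ?N. Pow T).
      of_nat (flag_f P S) * ((- 1) ^ card (T - S) * ?m T))"
    by (rule sum.reindex_bij_witness
        [where i = "\<lambda>(T, S). (S, T - S)" and j = "\<lambda>(S, U). (S \<union> U, S)"])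
      (auto simp: Un_absorb1 Un_Diff disjoint)
  also have "\<dots> = (\<Sum>T\<in>Pow ?N. \<Sum>S\<in>Pow T. of_nat (flag_f P S) * ((- 1) ^ card (T - S) * ?m T))"
    by (rule sum.Sigma[symmetric]) (auto intro: finite_subset)
  also have "\<dots> = (\<Sum>T\<in>Pow ?N. of_int (flag_h P T) * ?m T)"
    unfolding flag_h_def
    by (simp add: sum_distrib_right mult_of_nat_commute mult.assoc
        flip: mult_of_nat_commute)
  also have "\<dots> = (\<Sum>T\<in>Pow ?N. of_int (flag_h P T) * omega (mono_of height T))"
  proof (rule sum.cong[OF refl])
    fix T assume "T \<in> Pow ?N"
    then have "flag_h P T = 0 \<or> 0 \<notin> T"
      using flag_h_eq_0 by blast
    \<comment> \<open>The free entry is \<open>\<omega>\<close> of the word unless the first letter is \<open>b\<close>.\<close>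
    moreover have "?m T = omega (mono_of height T)" if "0 \<notin> T"
      using that by (cases "height = 0") (simp_all add: mono_of_eq segment_word_rec)
    ultimately show "of_int (flag_h P T) * ?m T = of_int (flag_h P T) * omega (mono_of height T)"
      by auto
  qed
  finally show ?thesis .
qed

end

section \<open>Expansion and nonnegativity\<close>

theorem corollary2p2:
  fixes P :: "'a::order set" and n :: nat
  assumes "fin_graded_bounded P"
    and "poset_rank P = n"
  shows "ex_ab_index P = (\<Sum>T\<in>Pow {0..<n}. of_int (flag_h P T) * omega (mono_of n T)) \<and>
    ((\<forall>T\<subseteq>{0..<n}. 0 \<le> flag_h P T) \<longrightarrow>
       (\<forall>m j. 0 \<le> coeff (Poly_Mapping.lookup (ex_ab_index P) m) j))"
proof (intro conjI impI)
  interpret graded_poset P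
    using assms(1) by unfold_locales
  show expansion: "ex_ab_index P = (\<Sum>T\<in>Pow {0..<n}. of_int (flag_h P T) * omega (mono_of n T))"
    using ex_ab_index_eq_sum_flag_h assms(2) by simp
  assume "\<forall>T\<subseteq>{0..<n}. 0 \<le> flag_h P T"
  then have "ab_nonneg (ex_ab_index P)"
    unfolding expansion by (intro ab_nonneg_sum ab_nonneg_mult ab_nonneg_of_int ab_nonneg_omega) auto
  then show "\<forall>m j. 0 \<le> coeff (Poly_Mapping.lookup (ex_ab_index P) m) j"
    by (simp add: ab_nonneg_def)
qed

end
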